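(* (Primorial conjecture for Eratosthenes sieve.) For every $k\ge 2$, $$\lim_{q\to\infty}\frac{N_{p_k^\#}(q^\#)}{N_{p_{k-1}^\#}(q^\#)}=\frac{p_k-1}{p_k-2},$$ where the limit is over primes $q$.
   Context: $p_k$ is the $k$-th prime ($p_1=2$). For a prime $p$, $p^\#$ denotes the primorial of $p$, the product of all primes from $2$ up to and including $p$. For an integer $N\ge 2$, the cycle of gaps $\mathcal{G}(N)=g_1 g_2\cdots g_{\phi(N)}$ is the cyclic sequence of differences between consecutive positive integers coprime to $N$, where $g_1$ is the difference between $1$ and the next larger integer coprime to $N$; it has $\phi(N)$ entries, which sum to $N$. For a positive integer $g$, $N_g(q^\#)$ is the number of indices $i\in\{1,\dots,\phi(q^\#)\}$ with $g_i=g$ in $\mathcal{G}(q^\#)$. *)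

theory Defs
  imports Complex_Main "HOL-Library.Infinite_Set" "HOL-Number_Theory.Totient"
begin

text \<open>Indexed from 1, so that \<open>nth_prime 1 = 2\<close>; the value at \<open>0\<close> is junk.\<close>
definition nth_prime :: "nat \<Rightarrow> nat"
  where "nth_prime k = enumerate {p. prime p} (k - 1)"

definition primorial :: "nat \<Rightarrow> nat"
  where "primorial p = \<Prod>{r. prime r \<and> r \<le> p}"

text \<open>The \<open>i\<close>-th positive integer coprime to \<open>N\<close>, indexed from 1, so that \<open>nth_coprime N 1 = 1\<close>.\<close>
definition nth_coprime :: "nat \<Rightarrow> nat \<Rightarrow> nat"
  where "nth_coprime N i = enumerate {m. m > 0 \<and> coprime m N} (i - 1)"

text \<open>The entry \<open>g\<^sub>i\<close> of the cycle of gaps of \<open>N\<close>. One period of the cycle is given by the indices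
  \<open>1, \<dots>, totient N\<close>; the last of these is the gap from \<open>N - 1\<close> to \<open>N + 1\<close>.\<close>
definition gap :: "nat \<Rightarrow> nat \<Rightarrow> nat"
  where "gap N i = nth_coprime N (i + 1) - nth_coprime N i"

definition gap_count :: "nat \<Rightarrow> nat \<Rightarrow> nat"
  where "gap_count g N = card {i \<in> {1..totient N}. gap N i = g}"

end

theory Submission
  imports Defs "HOL-Analysis.Harmonic_Numbers"
begin

text \<open>By the Chinese remainder theorem, the number of residues \<open>n\<close> modulo \<open>q\<^sup>#\<close> with both \<open>n\<close> and
  \<open>n + g\<close> coprime to \<open>q\<^sup>#\<close> is the product over primes \<open>p \<le> q\<close> of \<open>p - 1\<close> if \<open>p\<close> divides \<open>g\<close> and of
  \<open>p - 2\<close> otherwise. Such a pair fails to be a gap only if some \<open>n + h\<close> with \<open>0 < h < g\<close> is also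
  coprime to \<open>q\<^sup>#\<close>; for each \<open>h\<close> the proportion of these pairs is at most a constant times
  \<open>\<Prod>p\<le>q. 1 - 1/p\<close>, which tends to 0 by Euler's comparison with the harmonic series. Hence the gap
  counts are asymptotic to the pair counts, and for \<open>g = p\<^sub>k\<^sup>#\<close> and \<open>g = p\<^sub>k\<^sub>-\<^sub>1\<^sup>#\<close> the latter differ only
  in the factor at \<open>p\<^sub>k\<close>.\<close>

section \<open>Divergence of the Euler product\<close>

text \<open>A finite form of Euler's product identity, by induction on \<open>P\<close>. Allowing
  one more prime \<open>p\<close> adds only numbers \<open>p * k\<close> with \<open>k\<close>
  smooth over \<open>insert p P\<close>, so the reciprocal sum grows by at most a factor
  \<open>1 / (1 - 1/p)\<close>. The cutoff \<open>N\<close> keeps every sum finite.\<close>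

lemma smooth_harmonic_le_euler_product:
  fixes P :: "nat set"
  assumes "finite P" "\<And>p. p \<in> P \<Longrightarrow> prime p"
  shows "(\<Sum>m | 0 < m \<and> m \<le> N \<and> (\<forall>r. prime r \<longrightarrow> r dvd m \<longrightarrow> r \<in> P). 1 / real m) * (\<Prod>p\<in>P. 1 - 1 / real p) \<le> 1"
  using assms
proof (induction P rule: finite_induct)
  case empty
  have "{m. 0 < m \<and> m \<le> N \<and> (\<forall>r. prime r \<longrightarrow> r dvd m \<longrightarrow> r \<in> {})} \<subseteq> {1}"
    using prime_factor_nat by auto
  then have "(\<Sum>m | 0 < m \<and> m \<le> N \<and> (\<forall>r. prime r \<longrightarrow> r dvd m \<longrightarrow> r \<in> {}). 1 / real m) \<le> (\<Sum>m\<in>{1}. 1 / real m)"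
    by (intro sum_mono2) auto
  then show ?case by simp
next
  case (insert p P)
  define S where "S = (\<lambda>P. {m. 0 < m \<and> m \<le> N \<and> (\<forall>r. prime r \<longrightarrow> r dvd m \<longrightarrow> r \<in> P)})"
  define s where "s = (\<lambda>P. \<Sum>m\<in>S P. 1 / real m)"
  have fin: "finite (S P)" for P
    by (rule finite_subset[of _ "{..N}"]) (auto simp: S_def)
  have p: "prime p" "p > 1" using insert.prems prime_gt_1_nat by auto
  \<comment> \<open>The image on the right also contains numbers above \<open>N\<close>; this is
    harmless, since only an upper bound for the sum is wanted.\<close>
  have "S (insert p P) \<subseteq> S P \<union> (\<lambda>m. p * m) ` S (insert p P)"
  proof
    fix m assume m: "m \<in> S (insert p P)"
    show "m \<in> S P \<union> (\<lambda>m. p * m) ` S (insert p P)"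
    proof (cases "p dvd m")
      case True
      then obtain k where k: "m = p * k" by blast
      with m p have "k \<in> S (insert p P)"
        by (auto simp: S_def intro: order.trans[of k "p * k"])
      with k show ?thesis by blast
    next
      case False
      with m show ?thesis by (auto simp: S_def)
    qed
  qed
  then have "s (insert p P) \<le> (\<Sum>m\<in>S P \<union> (\<lambda>m. p * m) ` S (insert p P). 1 / real m)"
    unfolding s_def using fin by (intro sum_mono2) auto
  also have "\<dots> \<le> s P + (\<Sum>m\<in>(\<lambda>m. p * m) ` S (insert p P). 1 / real m)"
    unfolding s_def using fin by (subst sum.union_inter[symmetric]) (auto intro!: sum_nonneg)
  also have "(\<Sum>m\<in>(\<lambda>m. p * m) ` S (insert p P). 1 / real m) = s (insert p P) / real p"
    using p by (subst sum.reindex) (auto simp: inj_on_def s_def sum_divide_distrib mult.commute)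
  finally have "s (insert p P) * (1 - 1 / real p) \<le> s P"
    by (simp add: algebra_simps)
  moreover have "(\<Prod>p\<in>P. 1 - 1 / real p) \<ge> 0"
    using insert.prems prime_gt_0_nat by (intro prod_nonneg) (auto simp: Suc_le_eq)
  ultimately have "s (insert p P) * (1 - 1 / real p) * (\<Prod>p\<in>P. 1 - 1 / real p)
      \<le> s P * (\<Prod>p\<in>P. 1 - 1 / real p)"
    by (rule mult_right_mono)
  also have "\<dots> \<le> 1"
    using insert.IH insert.prems by (simp add: s_def S_def)
  finally show ?case
    using insert.hyps by (simp add: s_def S_def mult.assoc)
qed

text \<open>Every \<open>m \<le> n\<close> is smooth over the primes up to \<open>n\<close>, so the
  product is at most the reciprocal of the harmonic number, which exceeds the logarithm.\<close>

lemma euler_product_tendsto_0: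
  "(\<lambda>n. \<Prod>p | prime p \<and> p \<le> n. 1 - 1 / real p) \<longlonglongrightarrow> 0"
proof (rule tendsto_sandwich)
  let ?E = "\<lambda>n. \<Prod>p | prime p \<and> p \<le> n. 1 - 1 / real p"
  show "\<forall>\<^sub>F n in sequentially. 0 \<le> ?E n"
    by (intro always_eventually allI prod_nonneg) (auto simp: Suc_le_eq prime_gt_0_nat)
  show "\<forall>\<^sub>F n in sequentially. ?E n \<le> inverse (ln (real n + 1))"
    using eventually_gt_at_top[of 0]
  proof eventually_elim
    case (elim n)
    have "r \<le> n" if "r dvd m" "0 < m" "m \<le> n" for r m
      using that dvd_imp_le le_trans by blast
    then have range: "{m. 0 < m \<and> m \<le> n \<and> (\<forall>r. prime r \<longrightarrow> r dvd m \<longrightarrow> r \<in> {p. prime p \<and> p \<le> n})} = {1..n}"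
      unfolding set_eq_iff mem_Collect_eq atLeastAtMost_iff One_nat_def Suc_le_eq by blast
    have "(\<Sum>m\<in>{1..n}. 1 / real m) * ?E n \<le> 1"
      unfolding range[symmetric] by (rule smooth_harmonic_le_euler_product) auto
    then have "harm n * ?E n \<le> 1"
      unfolding harm_def inverse_eq_divide .
    moreover have "?E n \<ge> 0"
      by (intro prod_nonneg) (auto simp: Suc_le_eq prime_gt_0_nat)
    then have "ln (real n + 1) * ?E n \<le> harm n * ?E n"
      by (intro mult_right_mono) (use ln_le_harm[of n] in \<open>auto simp: add.commute\<close>)
    ultimately have "ln (real n + 1) * ?E n \<le> 1" by linarith
    then show ?case using elim by (simp add: field_simps)
  qed
  show "(\<lambda>n. inverse (ln (real n + 1))) \<longlonglongrightarrow> 0"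
    by (intro tendsto_inverse_0_at_top filterlim_compose[OF ln_at_top]
        filterlim_at_top_mono[OF filterlim_real_sequentially]) simp
qed auto

section \<open>Counting residues by the Chinese remainder theorem\<close>

text \<open>The Chinese remainder theorem in counting form. Reduction to the pair of residues is
  injective by coprimality, and surjective because both sides have \<open>a * b\<close>
  elements.\<close>

lemma card_residues_mult:
  fixes a b :: nat
  assumes "coprime a b" "a > 0" "b > 0"
  shows "card {n. n < a * b \<and> A (n mod a) \<and> B (n mod b)} = card {x. x < a \<and> A x} * card {y. y < b \<and> B y}"
proof -
  let ?f = "\<lambda>n. (n mod a, n mod b)"
  have inj: "inj_on ?f {..<a * b}"
  proof (rule inj_onI)
    fix x y assume xy: "x \<in> {..<a * b}" "y \<in> {..<a * b}" "?f x = ?f y"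
    then have "[x = y] (mod a)" "[x = y] (mod b)" by (auto simp: cong_def)
    then have "[x = y] (mod a * b)" using assms(1) coprime_cong_mult_nat by blast
    with xy show "x = y" by (auto simp: cong_def)
  qed
  have "?f ` {..<a * b} = {..<a} \<times> {..<b}"
    using assms by (intro card_subset_eq) (auto simp: card_image[OF inj])
  moreover have "?f ` {n. n < a * b \<and> A (n mod a) \<and> B (n mod b)}
      = ?f ` {..<a * b} \<inter> {(x, y). A x \<and> B y}"
    by auto
  ultimately have img: "?f ` {n. n < a * b \<and> A (n mod a) \<and> B (n mod b)}
      = {x. x < a \<and> A x} \<times> {y. y < b \<and> B y}"
    by auto
  have "inj_on ?f {n. n < a * b \<and> A (n mod a) \<and> B (n mod b)}"
    by (rule inj_on_subset[OF inj]) auto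
  from card_image[OF this] show ?thesis
    unfolding img card_cartesian_product by (rule sym)
qed

text \<open>A general shift set lets one counting formula serve both for \<open>{0, g}\<close>, the
  candidate gaps, and for \<open>{0, h, g}\<close>, the candidates interrupted at offset
  \<open>h\<close>.\<close>

definition sifted :: "nat set \<Rightarrow> nat set \<Rightarrow> nat set"
  where "sifted P H = {n. n < \<Prod>P \<and> (\<forall>p\<in>P. \<forall>h\<in>H. \<not> p dvd n + h)}"

lemma finite_sifted [simp]: "finite (sifted P H)"
  by (rule finite_subset[of _ "{..<\<Prod>P}"]) (auto simp: sifted_def)

text \<open>Each shift \<open>h\<close> excludes exactly the residue of \<open>-h\<close>, and
  negation is injective modulo \<open>p\<close>, so there are as many excluded residues as distinct
  residues of \<open>H\<close>.\<close>

lemma card_admissible_residues: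
  fixes p :: nat
  assumes "p > 0"
  shows "card {r. r < p \<and> (\<forall>h\<in>H. \<not> p dvd r + h)} = p - card ((\<lambda>h. h mod p) ` H)"
proof -
  \<comment> \<open>The outer \<open>mod p\<close> sends \<open>p - 0\<close> back to 0, so this is
    negation on the representatives below \<open>p\<close>.\<close>
  let ?neg = "\<lambda>x. (p - x) mod p"
  have inj: "inj_on ?neg {..<p}"
    using assms by (auto simp: inj_on_def mod_if split: if_splits)
  have *: "p dvd r + h \<longleftrightarrow> r = ?neg (h mod p)" if "r < p" for r h
  proof -
    have "p dvd r + h \<longleftrightarrow> p dvd r + h mod p"
      by (simp add: dvd_eq_mod_eq_0 mod_simps)
    also have "\<dots> \<longleftrightarrow> r + h mod p = 0 \<or> r + h mod p = p"
    proof
      assume "p dvd r + h mod p"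
      then obtain c where c: "r + h mod p = p * c" by blast
      moreover have "r + h mod p < p * 2"
        using that assms mod_less_divisor[of p h] by linarith
      ultimately have "c < 2" by simp
      with c show "r + h mod p = 0 \<or> r + h mod p = p" by (cases c) auto
    qed auto
    also have "\<dots> \<longleftrightarrow> r = ?neg (h mod p)"
    proof (cases "h mod p = 0")
      case False
      then have "?neg (h mod p) = p - h mod p" using assms by simp
      then show ?thesis using that False mod_less_divisor[OF assms, of h] by linarith
    qed (use that in simp)
    finally show ?thesis .
  qed
  have "{r. r < p \<and> (\<forall>h\<in>H. \<not> p dvd r + h)} = {..<p} - ?neg ` (\<lambda>h. h mod p) ` H"
    using * by auto
  moreover have "?neg ` (\<lambda>h. h mod p) ` H \<subseteq> {..<p}"
    using assms by auto
  moreover have "card (?neg ` (\<lambda>h. h mod p) ` H) = card ((\<lambda>h. h mod p) ` H)"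
    using assms by (intro card_image inj_on_subset[OF inj]) auto
  ultimately show ?thesis
    by (simp add: card_Diff_subset finite_subset)
qed

text \<open>Induction on \<open>P\<close>: the new prime is coprime to the product of the others, so
  its condition splits off as an independent factor.\<close>

lemma card_sifted:
  assumes "finite P" "\<And>p. p \<in> P \<Longrightarrow> prime p"
  shows "card (sifted P H) = (\<Prod>p\<in>P. p - card ((\<lambda>h. h mod p) ` H))"
  using assms
proof (induction P rule: finite_induct)
  case empty
  then show ?case by (simp add: sifted_def)
next
  case (insert p P)
  have "prime p" using insert.prems by simp
  then have "coprime p (\<Prod>P)"
    using insert by (intro prod_coprime_right primes_coprime) auto
  moreover have "\<Prod>P > 0"
    using insert.prems by (intro prod_pos) (auto simp: prime_gt_0_nat)
  \<comment> \<open>Divisibility by \<open>d\<close> survives reduction modulo a multiple of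
    \<open>d\<close>; this puts the sifting conditions into the shape of
    \<open>card_residues_mult\<close>.\<close>
  moreover have red: "d dvd n mod m + h \<longleftrightarrow> d dvd n + h" if "d dvd m" for d n m h :: nat
    using that by (metis dvd_mod_iff mod_add_left_eq)
  have "sifted (insert p P) H = {n. n < p * \<Prod>P \<and> (\<forall>h\<in>H. \<not> p dvd n mod p + h)
      \<and> (\<forall>r\<in>P. \<forall>h\<in>H. \<not> r dvd n mod \<Prod>P + h)}"
    using insert.hyps red dvd_prodI[of P _ "\<lambda>x. x"] by (auto simp: sifted_def)
  ultimately have "card (sifted (insert p P) H)
      = card {r. r < p \<and> (\<forall>h\<in>H. \<not> p dvd r + h)} * card (sifted P H)"
    using card_residues_mult[of p "\<Prod>P" "\<lambda>x. \<forall>h\<in>H. \<not> p dvd x + h" "\<lambda>x. \<forall>r\<in>P. \<forall>h\<in>H. \<not> r dvd x + h"]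
      \<open>prime p\<close> by (simp add: prime_gt_0_nat sifted_def)
  then show ?case
    using insert \<open>prime p\<close> by (simp add: card_admissible_residues prime_gt_0_nat)
qed

section \<open>Gaps as pairs of consecutive totatives\<close>

lemma infinite_positive_coprimes:
  fixes N :: nat
  assumes "N > 0"
  shows "infinite {m. m > 0 \<and> coprime m N}"
proof (rule infinite_super)
  have "coprime (i * N + 1) N" for i
    by (metis coprime_iff_gcd_eq_1 gcd.commute gcd_add_mult gcd_1_nat)
  then show "range (\<lambda>i. i * N + 1) \<subseteq> {m. m > 0 \<and> coprime m N}"
    by auto
  show "infinite (range (\<lambda>i. i * N + 1))"
    using assms by (intro range_inj_infinite) (auto simp: inj_on_def)
qed

text \<open>The next element is the least member of \<open>S\<close> above the current one, so the
  difference is the first positive offset that lands in \<open>S\<close>.\<close>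

lemma enumerate_Suc_eq_iff:
  fixes S :: "nat set"
  assumes "infinite S" "g > 0"
  shows "enumerate S (Suc i) - enumerate S i = g \<longleftrightarrow>
    enumerate S i + g \<in> S \<and> (\<forall>h\<in>{0<..<g}. enumerate S i + h \<notin> S)"
proof -
  let ?x = "enumerate S i" and ?y = "enumerate S (Suc i)"
  have y: "?y = (LEAST s. s \<in> S \<and> ?x < s)" by (rule enumerate_Suc''[OF assms(1)])
  have xy: "?x < ?y" "?y \<in> S" using assms by (auto simp: enumerate_in_set)
  have no: "s \<notin> S" if "?x < s" "s < ?y" for s
    using not_less_Least[of s "\<lambda>s. s \<in> S \<and> ?x < s"] that y by auto
  show ?thesis
  proof
    assume "?y - ?x = g"
    then have "?y = ?x + g" using xy by simp
    then show "?x + g \<in> S \<and> (\<forall>h\<in>{0<..<g}. ?x + h \<notin> S)" using no xy by auto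
  next
    assume *: "?x + g \<in> S \<and> (\<forall>h\<in>{0<..<g}. ?x + h \<notin> S)"
    have "?x + g \<ge> ?y" using no[of "?x + g"] * assms by force
    moreover have "\<not> ?y < ?x + g"
    proof
      assume "?y < ?x + g"
      then have "?y - ?x \<in> {0<..<g}" "?x + (?y - ?x) \<in> S" using xy by auto
      then show False using * by blast
    qed
    ultimately show "?y - ?x = g" by simp
  qed
qed

text \<open>Used to pass from indices to elements. Cardinalities agree, so one inclusion suffices;
  if an index \<open>i\<close> in the range gave a value above \<open>N\<close>, all members up to
  \<open>N\<close> would have indices below \<open>i\<close>, which is too few.\<close>

lemma enumerate_image_initial_segment:
  fixes S :: "nat set"
  assumes "infinite S"
  shows "enumerate S ` {..<card (S \<inter> {..N})} = S \<inter> {..N}"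
proof (rule card_subset_eq)
  have inj: "inj_on (enumerate S) A" for A
    using inj_enumerate[OF assms] inj_on_subset by blast
  show "card (enumerate S ` {..<card (S \<inter> {..N})}) = card (S \<inter> {..N})"
    by (simp add: card_image inj)
  show "enumerate S ` {..<card (S \<inter> {..N})} \<subseteq> S \<inter> {..N}"
  proof (rule ccontr)
    assume "\<not> ?thesis"
    then obtain i where i: "i < card (S \<inter> {..N})" "enumerate S i > N"
      using enumerate_in_set[OF assms] by fastforce
    have "S \<inter> {..N} \<subseteq> enumerate S ` {..<i}"
    proof
      fix s assume s: "s \<in> S \<inter> {..N}"
      then obtain j where j: "enumerate S j = s" using enumerate_Ex[OF assms] by blast
      then have "enumerate S j < enumerate S i" using s i by simp
      then show "s \<in> enumerate S ` {..<i}" using j assms by auto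
    qed
    then have "card (S \<inter> {..N}) \<le> card (enumerate S ` {..<i})" by (intro card_mono) auto
    also have "\<dots> = i" by (simp add: card_image inj)
    finally show False using i by simp
  qed
qed simp

text \<open>Each gap of the period is identified with its left endpoint. The right endpoint
  \<open>n + g\<close> may exceed \<open>N\<close>, as it does for the gap that starts at
  \<open>N - 1\<close>.\<close>

lemma gap_count_eq_card:
  assumes "N > 1" "g > 0"
  shows "gap_count g N = card {n. n < N \<and> coprime n N \<and> coprime (n + g) N
    \<and> (\<forall>h\<in>{0<..<g}. \<not> coprime (n + h) N)}"
proof -
  define S where "S = {m. m > 0 \<and> coprime m N}"
  have S: "infinite S" using infinite_positive_coprimes assms by (simp add: S_def)
  have seg: "S \<inter> {..N} = totatives N" by (auto simp: S_def in_totatives_iff)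
  then have img: "enumerate S ` {..<totient N} = totatives N"
    using enumerate_image_initial_segment[OF S, of N] by (simp add: totient_def)
  define G where "G = {n. n < N \<and> coprime n N \<and> coprime (n + g) N
    \<and> (\<forall>h\<in>{0<..<g}. \<not> coprime (n + h) N)}"
  \<comment> \<open>\<open>totatives N\<close> lies in \<open>{1..N}\<close>, whereas residues start
    at 0; since \<open>N > 1\<close>, neither 0 nor \<open>N\<close> is coprime to \<open>N\<close>,
    and the two ranges agree.\<close>
  have tot: "totatives N = {n. n < N \<and> coprime n N}"
  proof -
    have "n > 0" if "coprime n N" for n using that assms by (cases n) auto
    moreover have "n < N" if "coprime n N" "n \<le> N" for n
      using that assms by (cases "n = N") auto
    ultimately show ?thesis by (auto simp: in_totatives_iff)
  qed
  have S_add: "n + h \<in> S \<longleftrightarrow> coprime (n + h) N" if "h > 0" for n h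
    using that by (auto simp: S_def)
  define I where "I = {i. i < totient N \<and> enumerate S i \<in> G}"
  \<comment> \<open>Gaps are indexed from 1 and \<open>enumerate\<close> from 0, hence the shift by
    \<open>Suc\<close>.\<close>
  have "{i \<in> {1..totient N}. gap N i = g} = Suc ` I"
  proof -
    have key: "gap N (Suc i) = g \<longleftrightarrow> enumerate S i \<in> G" if "i < totient N" for i
    proof -
      have "enumerate S i \<in> totatives N" using img that by blast
      then show ?thesis
        using enumerate_Suc_eq_iff[OF S assms(2), of i] S_add assms(2)
        by (auto simp: gap_def nth_coprime_def S_def[symmetric] G_def tot)
    qed
    show ?thesis
    proof (intro equalityI subsetI)
      fix i assume "i \<in> {i \<in> {1..totient N}. gap N i = g}"
      then show "i \<in> Suc ` I" using key[of "i - 1"] by (cases i) (auto simp: I_def)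
    qed (auto simp: I_def key)
  qed
  then have "gap_count g N = card I" by (simp add: gap_count_def card_image)
  also have "card I = card (enumerate S ` I)"
    using inj_enumerate[OF S] by (metis card_image inj_on_subset subset_UNIV)
  also have "enumerate S ` I = G"
  proof -
    have "G \<subseteq> enumerate S ` {..<totient N}" unfolding img tot G_def by auto
    then show ?thesis unfolding I_def by (auto simp: image_iff)
  qed
  finally show ?thesis by (simp add: G_def)
qed

section \<open>Asymptotics\<close>

abbreviation primes_upto :: "nat \<Rightarrow> nat set"
  where "primes_upto q \<equiv> {p. prime p \<and> p \<le> q}"

lemma coprime_primorial_iff:
  "coprime m (primorial q) \<longleftrightarrow> (\<forall>p\<in>primes_upto q. \<not> p dvd m)"
proof
  assume *: "coprime m (primorial q)"
  show "\<forall>p\<in>primes_upto q. \<not> p dvd m"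
  proof
    fix p assume p: "p \<in> primes_upto q"
    then have "p dvd primorial q" unfolding primorial_def by (intro dvd_prodI[of _ _ "\<lambda>x. x", simplified]) auto
    with p * show "\<not> p dvd m" using coprime_common_divisor not_prime_unit by blast
  qed
next
  assume "\<forall>p\<in>primes_upto q. \<not> p dvd m"
  then show "coprime m (primorial q)"
    unfolding primorial_def
    by (intro prod_coprime_right) (metis coprime_commute mem_Collect_eq prime_imp_coprime)
qed

lemma prime_dvd_primorial_iff:
  assumes "prime p"
  shows "p dvd primorial q \<longleftrightarrow> p \<le> q"
  using assms coprime_primorial_iff[of p q]
  by (metis (mono_tags, lifting) coprime_primorial_iff dvd_refl mem_Collect_eq prime_imp_coprime
      primes_dvd_imp_eq coprime_absorb_left not_prime_unit)

lemma primorial_pos: "primorial q > 0"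
  unfolding primorial_def by (intro prod_pos) (auto simp: prime_gt_0_nat)

text \<open>The endpoints of a gap form an admissible pair. Conversely, an admissible pair that is
  not a gap has a totative at some intermediate offset \<open>h\<close>, hence is counted for
  \<open>{0, h, g}\<close>; the union bound over \<open>h\<close> gives the second estimate.\<close>

lemma gap_count_primorial_bounds:
  assumes "q \<ge> 2" "g > 0"
  shows "gap_count g (primorial q) \<le> card (sifted (primes_upto q) {0, g})"
    and "card (sifted (primes_upto q) {0, g}) \<le>
      gap_count g (primorial q) + (\<Sum>h\<in>{0<..<g}. card (sifted (primes_upto q) {0, h, g}))"
proof -
  have "2 dvd primorial q" using prime_dvd_primorial_iff[of 2] assms by simp
  then have "primorial q > 1" using dvd_imp_le[OF _ primorial_pos] by fastforce
  define G where "G = {n. n < primorial q \<and> coprime n (primorial q) \<and> coprime (n + g) (primorial q)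
    \<and> (\<forall>h\<in>{0<..<g}. \<not> coprime (n + h) (primorial q))}"
  have gc: "gap_count g (primorial q) = card G"
    unfolding G_def by (rule gap_count_eq_card[OF \<open>primorial q > 1\<close> assms(2)])
  have sift: "sifted (primes_upto q) H = {n. n < primorial q \<and> (\<forall>h\<in>H. coprime (n + h) (primorial q))}" for H
    unfolding sifted_def coprime_primorial_iff by (auto simp: primorial_def)
  show "gap_count g (primorial q) \<le> card (sifted (primes_upto q) {0, g})"
    unfolding gc by (intro card_mono) (auto simp: sift G_def simp del: finite_sifted intro: finite_sifted)
  have "finite G" unfolding G_def by simp
  have "sifted (primes_upto q) {0, g} \<subseteq> G \<union> (\<Union>h\<in>{0<..<g}. sifted (primes_upto q) {0, h, g})"
    unfolding sift G_def by auto
  then have "card (sifted (primes_upto q) {0, g})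
      \<le> card (G \<union> (\<Union>h\<in>{0<..<g}. sifted (primes_upto q) {0, h, g}))"
    using \<open>finite G\<close> by (intro card_mono) auto
  also have "\<dots> \<le> card G + card (\<Union>h\<in>{0<..<g}. sifted (primes_upto q) {0, h, g})"
    by (rule card_Un_le)
  also have "\<dots> \<le> card G + (\<Sum>h\<in>{0<..<g}. card (sifted (primes_upto q) {0, h, g}))"
    by (intro add_left_mono card_UN_le) simp
  finally show "card (sifted (primes_upto q) {0, g}) \<le>
      gap_count g (primorial q) + (\<Sum>h\<in>{0<..<g}. card (sifted (primes_upto q) {0, h, g}))"
    unfolding gc .
qed

text \<open>The shifts 0 and \<open>g\<close> occupy the same residue class exactly when
  \<open>p\<close> divides \<open>g\<close>.\<close>

lemma card_pair_mod:
  fixes p g :: nat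
  shows "card ((\<lambda>h. h mod p) ` {0, g}) = (if p dvd g then 1 else 2)"
  by (auto simp: dvd_eq_mod_eq_0)

lemma card_sifted_pair:
  "card (sifted (primes_upto q) {0, g}) = (\<Prod>p\<in>primes_upto q. p - (if p dvd g then 1 else 2))"
  by (subst card_sifted) (simp_all only: card_pair_mod, auto)

text \<open>For even \<open>g\<close> the prime 2 contributes \<open>2 - 1\<close> and not
  \<open>2 - 2\<close>, and an odd prime contributes at least \<open>p - 2 > 0\<close>. The pair
  counts can therefore serve as denominators.\<close>

lemma card_sifted_pair_pos:
  assumes "even g"
  shows "card (sifted (primes_upto q) {0, g}) > 0"
proof -
  have "p - (if p dvd g then 1 else 2) > 0" if "prime p" for p
    using assms prime_ge_2_nat[OF that] by (cases "p = 2") auto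
  then show ?thesis unfolding card_sifted_pair by (intro prod_pos) auto
qed

text \<open>The ratio is a product of local factors \<open>f p\<close>. For \<open>p > g\<close> the
  shifts are distinct modulo \<open>p\<close>, and \<open>f p = 1 - 1/(p - 2) \<le> 1 - 1/p\<close>;
  the finitely many other factors are at most 1. Comparison with the Euler product finishes the
  proof.\<close>

lemma sifted_triple_pair_ratio_tendsto_0:
  assumes "even g" "h \<in> {0<..<g}"
  shows "(\<lambda>q. real (card (sifted (primes_upto q) {0, h, g})) / real (card (sifted (primes_upto q) {0, g})))
    \<longlonglongrightarrow> 0"
proof -
  define f where "f = (\<lambda>p. real (p - card ((\<lambda>h. h mod p) ` {0, h, g})) / real (p - (if p dvd g then 1 else 2)))"
  define e where "e = (\<lambda>p. 1 - 1 / real p)"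
  \<comment> \<open>\<open>C\<close> cancels the Euler factors at primes up to \<open>g\<close>,
    where \<open>f\<close> is bounded only by 1.\<close>
  define C where "C = inverse (\<Prod>p\<in>primes_upto g. e p)"
  have ratio: "real (card (sifted (primes_upto q) {0, h, g})) / real (card (sifted (primes_upto q) {0, g}))
      = (\<Prod>p\<in>primes_upto q. f p)" for q
    unfolding card_sifted_pair f_def
    by (subst card_sifted) (auto simp: prod_dividef simp del: image_insert)
  have e: "e p > 0" if "prime p" for p
    using prime_gt_1_nat[OF that] by (simp add: e_def)
  have f0: "f p \<ge> 0" for p by (simp add: f_def)
  \<comment> \<open>An additional shift can only enlarge the set of excluded residues.\<close>
  have f1: "f p \<le> 1" if "prime p" for p
  proof -
    have "card ((\<lambda>h. h mod p) ` {0, g}) \<le> card ((\<lambda>h. h mod p) ` {0, h, g})"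
      by (intro card_mono) auto
    then have "p - card ((\<lambda>h. h mod p) ` {0, h, g}) \<le> p - (if p dvd g then 1 else 2)"
      unfolding card_pair_mod by linarith
    then show ?thesis unfolding f_def by (intro divide_le_eq_1[THEN iffD2]) linarith
  qed
  have fe: "f p \<le> e p" if "prime p" "p > g" for p
  proof -
    \<comment> \<open>From \<open>0 < h < g\<close> follows \<open>g \<ge> 2\<close>, so
      \<open>p > g\<close> gives \<open>p \<ge> 3\<close>.\<close>
    have "p \<ge> 3" "\<not> p dvd g" using that assms by (auto dest: dvd_imp_le)
    moreover have "(\<lambda>h. h mod p) ` {0, h, g} = {0, h, g}" using that assms by auto
    then have "card ((\<lambda>h. h mod p) ` {0, h, g}) = 3" using assms by simp
    ultimately have "f p = (real p - 3) / (real p - 2)"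
      by (simp add: f_def of_nat_diff del: image_insert)
    also have "\<dots> = 1 - 1 / (real p - 2)"
      using \<open>p \<ge> 3\<close> by (simp add: field_simps)
    also have "\<dots> \<le> e p"
      unfolding e_def using \<open>p \<ge> 3\<close> by (intro diff_left_mono frac_le) auto
    finally show ?thesis .
  qed
  have "(\<Prod>p\<in>primes_upto q. f p) \<le> C * (\<Prod>p\<in>primes_upto q. e p)" if "q \<ge> g" for q
  proof -
    have split: "primes_upto q = primes_upto g \<union> {p. prime p \<and> g < p \<and> p \<le> q}"
      using that by auto
    have prod_split: "(\<Prod>p\<in>primes_upto q. F p)
        = (\<Prod>p\<in>primes_upto g. F p) * (\<Prod>p | prime p \<and> g < p \<and> p \<le> q. F p)" for F :: "nat \<Rightarrow> real"
      unfolding split by (intro prod.union_disjoint) auto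
    have "(\<Prod>p\<in>primes_upto q. f p) \<le> 1 * (\<Prod>p | prime p \<and> g < p \<and> p \<le> q. e p)"
      unfolding prod_split using f0 f1 fe
      by (intro mult_mono prod_le_1 prod_mono prod_nonneg) auto
    also have "\<dots> = C * (\<Prod>p\<in>primes_upto q. e p)"
    proof -
      have "(\<Prod>p\<in>primes_upto g. e p) > 0" using e by (intro prod_pos) auto
      then show ?thesis
        unfolding prod_split C_def mult.assoc[symmetric] by (subst left_inverse) linarith+
    qed
    finally show ?thesis .
  qed
  then have upper: "\<forall>\<^sub>F q in sequentially. (\<Prod>p\<in>primes_upto q. f p) \<le> C * (\<Prod>p\<in>primes_upto q. e p)"
    by (rule eventually_sequentiallyI)
  have lower: "\<forall>\<^sub>F q in sequentially. 0 \<le> (\<Prod>p\<in>primes_upto q. f p)"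
    by (intro always_eventually allI prod_nonneg f0)
  have "(\<lambda>q. C * (\<Prod>p\<in>primes_upto q. e p)) \<longlonglongrightarrow> 0"
    unfolding e_def by (rule tendsto_mult_right_zero[OF euler_product_tendsto_0])
  then show ?thesis
    unfolding ratio by (rule tendsto_sandwich[OF lower upper tendsto_const])
qed

text \<open>Dividing the bounds by the pair count leaves an error that is a sum over the fixed
  finite range \<open>0 < h < g\<close>, and each term tends to 0.\<close>

lemma gap_count_asymp_sifted_pair:
  assumes "even g" "g > 0"
  shows "(\<lambda>q. real (gap_count g (primorial q)) / real (card (sifted (primes_upto q) {0, g}))) \<longlonglongrightarrow> 1"
proof (rule tendsto_sandwich)
  let ?T = "\<lambda>H q. real (card (sifted (primes_upto q) H))"
  have pos: "?T {0, g} q > 0" for q using card_sifted_pair_pos assms by simp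
  show "(\<lambda>q. 1 - (\<Sum>h\<in>{0<..<g}. ?T {0, h, g} q / ?T {0, g} q)) \<longlonglongrightarrow> 1"
  proof -
    have "(\<lambda>q. \<Sum>h\<in>{0<..<g}. ?T {0, h, g} q / ?T {0, g} q) \<longlonglongrightarrow> (\<Sum>h\<in>{0<..<g}. 0)"
      by (intro tendsto_sum sifted_triple_pair_ratio_tendsto_0 assms)
    from tendsto_diff[OF tendsto_const[of 1] this] show ?thesis by simp
  qed
  show "\<forall>\<^sub>F q in sequentially. 1 - (\<Sum>h\<in>{0<..<g}. ?T {0, h, g} q / ?T {0, g} q)
      \<le> real (gap_count g (primorial q)) / ?T {0, g} q"
    using eventually_ge_at_top[of 2]
  proof eventually_elim
    case (elim q)
    have "?T {0, g} q \<le> real (gap_count g (primorial q)) + (\<Sum>h\<in>{0<..<g}. ?T {0, h, g} q)"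
      using gap_count_primorial_bounds(2)[OF elim assms(2)] unfolding of_nat_sum[symmetric] of_nat_add[symmetric]
      by (rule of_nat_mono)
    then have "(?T {0, g} q - (\<Sum>h\<in>{0<..<g}. ?T {0, h, g} q)) / ?T {0, g} q
        \<le> real (gap_count g (primorial q)) / ?T {0, g} q"
      using pos[of q] by (intro divide_right_mono) linarith+
    moreover have "?T {0, g} q / ?T {0, g} q = 1"
      using pos[of q] by (intro divide_self) linarith
    ultimately show ?case
      by (simp only: diff_divide_distrib sum_divide_distrib)
  qed
  show "\<forall>\<^sub>F q in sequentially. real (gap_count g (primorial q)) / ?T {0, g} q \<le> 1"
    using eventually_ge_at_top[of 2]
  proof eventually_elim
    case (elim q)
    then show ?case using gap_count_primorial_bounds(1)[OF elim assms(2)] pos[of q] by simp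
  qed
qed simp

text \<open>Here \<open>r\<close> acts as the predecessor of \<open>p\<close> among the primes. A
  prime other than \<open>p\<close> divides both primorials or neither, so all factors cancel except
  \<open>p - 1\<close> over \<open>p - 2\<close> at \<open>p\<close>. The ratio is exact for every
  \<open>q \<ge> p\<close>.\<close>

lemma sifted_pair_primorial_ratio:
  assumes "prime p" "p > 2" "p \<le> q" "primes_upto p = insert p (primes_upto r)" "r < p"
  shows "real (card (sifted (primes_upto q) {0, primorial p})) / real (card (sifted (primes_upto q) {0, primorial r}))
    = (real p - 1) / (real p - 2)"
proof -
  define c where "c = (\<lambda>x s. real (s - (if s \<le> x then 1 else 2)))"
  have T: "real (card (sifted (primes_upto q) {0, primorial x})) = (\<Prod>s\<in>primes_upto q. c x s)" for x
    unfolding card_sifted_pair of_nat_prod c_def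
    by (intro prod.cong refl) (auto simp: prime_dvd_primorial_iff)
  have mem: "p \<in> primes_upto q" using assms by simp
  have "(\<Prod>s\<in>primes_upto q - {p}. c p s) = (\<Prod>s\<in>primes_upto q - {p}. c r s)"
    using assms(4) by (intro prod.cong refl) (auto simp: c_def set_eq_iff)
  moreover have "(\<Prod>s\<in>primes_upto q - {p}. c r s) \<noteq> 0"
  proof -
    have "2 \<in> primes_upto p" using assms(2) by simp
    \<comment> \<open>Since \<open>p > 2\<close>, the prime 2 belongs to
      \<open>primes_upto r\<close>; its factor is then 1, so the common product can be
      cancelled.\<close>
    then have "r \<ge> 2" unfolding assms(4) using assms(2) by auto
    have "c r s \<noteq> 0" if "prime s" for s
      using prime_ge_2_nat[OF that] \<open>r \<ge> 2\<close> by (auto simp: c_def)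
    then show ?thesis by (subst prod_zero_iff) auto
  qed
  moreover have "(\<Prod>s\<in>primes_upto q. c x s) = c x p * (\<Prod>s\<in>primes_upto q - {p}. c x s)" for x
    by (rule prod.remove[OF _ mem]) simp
  ultimately have "(\<Prod>s\<in>primes_upto q. c p s) / (\<Prod>s\<in>primes_upto q. c r s) = c p p / c r p"
    by simp
  also have "\<dots> = (real p - 1) / (real p - 2)"
    using assms by (simp add: c_def of_nat_diff)
  finally show ?thesis unfolding T .
qed

text \<open>The enumeration of the primes is increasing, and no index lies strictly between
  \<open>k - 2\<close> and \<open>k - 1\<close>, the zero-based positions of the two primes.\<close>

lemma primes_upto_nth_prime:
  assumes "k \<ge> 2"
  shows "primes_upto (nth_prime k) = insert (nth_prime k) (primes_upto (nth_prime (k - 1)))"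
proof -
  let ?e = "enumerate {p::nat. prime p}"
  have k: "k - 1 = Suc (k - 2)" using assms by simp
  have "s \<le> ?e (k - 2) \<or> s = ?e (k - 1)" if s: "prime s" "s \<le> ?e (k - 1)" for s
  proof -
    obtain j where j: "?e j = s" using enumerate_Ex[OF primes_infinite] s by blast
    then have "j \<le> k - 1" using s primes_infinite enumerate_mono_le_iff by blast
    then have "j \<le> k - 2 \<or> j = k - 1" using k by linarith
    then show ?thesis using j enumerate_mono_le_iff[OF primes_infinite, of j "k - 2"] by blast
  qed
  moreover have "?e (k - 2) < ?e (k - 1)" using k primes_infinite by simp
  moreover have "prime (?e (k - 1))" using enumerate_in_set[OF primes_infinite] by blast
  ultimately show ?thesis
    using k by (auto simp: nth_prime_def numeral_2_eq_2)
qed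

lemma prime_nth_prime: "prime (nth_prime k)"
  unfolding nth_prime_def using enumerate_in_set[OF primes_infinite] by blast

lemma nth_prime_less:
  assumes "k \<ge> 2"
  shows "nth_prime (k - 1) < nth_prime k"
  unfolding nth_prime_def using assms by (intro enumerate_mono primes_infinite) auto

theorem mainTheorem3:
  fixes k :: nat
  assumes "k \<ge> 2"
  shows "((\<lambda>q::nat. real (gap_count (primorial (nth_prime k)) (primorial q)) /
                    real (gap_count (primorial (nth_prime (k - 1))) (primorial q)))
          \<longlongrightarrow> (real (nth_prime k) - 1) / (real (nth_prime k) - 2))
         (inf at_top (principal {q. prime q}))"
proof -
  define p r where "p = nth_prime k" and "r = nth_prime (k - 1)"
  define T where "T = (\<lambda>x q. real (card (sifted (primes_upto q) {0, primorial x})))"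
  define G where "G = (\<lambda>x q. real (gap_count (primorial x) (primorial q)))"
  have r: "r \<ge> 2" unfolding r_def by (intro prime_ge_2_nat prime_nth_prime)
  have rp: "r < p" unfolding r_def p_def by (rule nth_prime_less[OF assms])
  have even: "even (primorial x)" if "x \<ge> 2" for x
    using prime_dvd_primorial_iff[of 2 x] that by simp
  have lim: "(\<lambda>q. G x q / T x q) \<longlonglongrightarrow> 1" if "x \<ge> 2" for x
    unfolding G_def T_def by (rule gap_count_asymp_sifted_pair[OF even[OF that] primorial_pos])
  have T: "T x q \<noteq> 0" if "x \<ge> 2" for x q
    using card_sifted_pair_pos[OF even[OF that], of q] unfolding T_def by linarith
  \<comment> \<open>The ratio of gap counts is split into two normalized gap counts, each tending to
    1, and the ratio of pair counts, which is constant once \<open>q \<ge> p\<close>.\<close>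
  have "(\<lambda>q. (G p q / T p q) / (G r q / T r q) * ((real p - 1) / (real p - 2)))
      \<longlonglongrightarrow> 1 / 1 * ((real p - 1) / (real p - 2))"
    using r rp by (intro tendsto_intros lim) auto
  moreover have "\<forall>\<^sub>F q in sequentially.
      (G p q / T p q) / (G r q / T r q) * ((real p - 1) / (real p - 2)) = G p q / G r q"
    using eventually_ge_at_top[of p]
  proof eventually_elim
    case (elim q)
    have "T p q / T r q = (real p - 1) / (real p - 2)"
      unfolding T_def using r rp elim primes_upto_nth_prime[OF assms] prime_nth_prime
      by (intro sifted_pair_primorial_ratio) (auto simp: p_def r_def)
    \<comment> \<open>Only the pair counts have to be nonzero here: if \<open>G r q = 0\<close>,
      both sides are 0 by the convention for division by zero.\<close>
    then show ?case using T[of p q] T[of r q] r rp by (simp add: field_simps flip: \<open>T p q / T r q = _\<close>)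
  qed
  ultimately have "(\<lambda>q. G p q / G r q) \<longlonglongrightarrow> (real p - 1) / (real p - 2)"
    by (simp add: tendsto_cong)
  \<comment> \<open>The limit over all natural numbers \<open>q\<close> restricts to the limit over
    primes, whose filter is finer.\<close>
  then show ?thesis
    unfolding G_def p_def r_def by (rule tendsto_mono[OF inf_le1])
qed

end
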